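(* Consider the prompt-based federated learning model described in the context. For every iteration $t\ge 0$ and every client $k\in[K]$ there are real coefficients $\alpha_{k,k'}^{(t)},\gamma_{k,k'}^{(t)}$ ($k'\in[K]$), $\beta_k^{(t)}$, and $\phi_{k,l}^{(t)}$ ($l\in[L]$) such that the learnable prompt of client $k$ is $$\mathbf{p}_{k}^{(t)} = \beta_{k}^{(t)} \|\boldsymbol{\mu}_G\|_2^{-2} \boldsymbol{\mu}_G + \sum_{k'=1}^K \left(\alpha_{k, k'}^{(t)} \mathbf{p}_{k'}^{(0)} + \gamma_{k, k'}^{(t)} \|\boldsymbol{\mu}_{k'}\|_2^{-2} \boldsymbol{\mu}_{k'}\right) + \sum_{l = 1}^L \phi_{k, l}^{(t)} \|\boldsymbol{\xi}_{l}\|_2^{-2} \boldsymbol{\xi}_{l},$$ and the aggregated prompt $\overline{\mathbf p}^{(t)}=\sum_{k=1}^K\frac{n_k}{n}\mathbf p_k^{(t)}$ is $$\overline{\mathbf{p}}^{(t)} = \overline{\beta}^{(t)} \|\boldsymbol{\mu}_G\|_2^{-2} \boldsymbol{\mu}_G + \sum_{k=1}^K \left(\overline{\alpha}_{k}^{(t)} \mathbf{p}_{k}^{(0)} + \overline{\gamma}_{k}^{(t)} \|\boldsymbol{\mu}_{k}\|_2^{-2} \boldsymbol{\mu}_{k}\right) + \sum_{l = 1}^L \overline{\phi}_{l}^{(t)} \|\boldsymbol{\xi}_{l}\|_2^{-2} \boldsymbol{\xi}_{l},$$ where the overlined coefficients are the averaged versions of the client coefficients: $\overline\beta^{(t)}=\sum_{j}\frac{n_j}{n}\beta_j^{(t)}$,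 $\overline\alpha_{k}^{(t)}=\sum_j\frac{n_j}{n}\alpha_{j,k}^{(t)}$, $\overline\gamma_{k}^{(t)}=\sum_j\frac{n_j}{n}\gamma_{j,k}^{(t)}$, $\overline\phi_l^{(t)}=\sum_j\frac{n_j}{n}\phi_{j,l}^{(t)}$.
   Context: Features. Let $K,S,L\ge 1$ be integers and $m=1+S+L$. Let $\boldsymbol\mu_G,\boldsymbol\nu_1,\dots,\boldsymbol\nu_S,\boldsymbol\xi_1,\dots,\boldsymbol\xi_L\in\mathbb R^m$ be nonzero, pairwise orthogonal vectors (global task-relevant, local task-relevant and task-irrelevant features). Each client $k\in[K]=\{1,\dots,K\}$ has a local signal $\boldsymbol\mu_k=\boldsymbol\nu_{s(k)}$ for some $s(k)\in[S]$, sampled from a discrete distribution on the $\boldsymbol\nu_s$. Text encoder. $\mathbf W\in\mathbb R^{m\times m}$ is the fixed matrix whose rows are $\boldsymbol\mu_G^T,\boldsymbol\nu_1^T,\dots,\boldsymbol\nu_S^T,\boldsymbol\xi_1^T,\dots,\boldsymbol\xi_L^T$. There are two fixed class prompts $\mathbf p_{+1},\mathbf p_{-1}\in\mathbb R^m$. For a learnable prompt $\mathbf p$ and label $y\in\{\pm1\}$ the text feature is $h(\mathbf p,\mathbf p_y)=\sigma(\mathbf W\mathbf p+\mathbf W\mathbf p_y)-\sigma(-\mathbf W\mathbf p+\mathbf W\mathbf p_y)$, where $\sigma$ is an activation function applied coordinatewise, with derivative $\sigma'$. Data. Client $k$ has $n_k$ samples with labels $y_{k,i}\in\{\pm1\}$,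 and $n=\sum_k n_k$. The image feature $\mathbf g_{k,i}\in\mathbb R^m$ has first coordinate $y_{k,i}$, coordinate $1+s(k)$ equal to $y_{k,i}$, the other coordinates among $2,\dots,1+S$ equal to $0$, and last $L$ coordinates $x_{k,i,1},\dots,x_{k,i,L}$, independent $\mathcal N(0,\sigma_p^2)$. Training. Client $k$'s loss is the logistic loss $L_k(\mathbf p)=\frac1{n_k}\sum_{i=1}^{n_k}\log\left(1+\exp(-\langle \mathbf g_{k,i},h(\mathbf p,\mathbf p_{y_{k,i}})\rangle)\right)$. Starting from $\mathbf p_k^{(0)}$, client $k$ performs gradient steps $\mathbf p_k^{(t+1)}=\mathbf p_k^{(t)}-\eta\nabla L_k(\mathbf p_k^{(t)})$ with step size $\eta$, and after every $E$ local steps (one communication round) all client prompts are replaced by the FedAvg average $\sum_{k}\frac{n_k}{n}\mathbf p_k$. *)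

theory Defs
  imports "HOL-Probability.Probability"
begin

text \<open>The \<open>1 + S + L\<close> coordinates of the feature space: the global one (\<open>Inl ()\<close>), the \<open>S\<close> local
  task-relevant ones (\<open>Inr (Inl s)\<close>) and the \<open>L\<close> task-irrelevant ones (\<open>Inr (Inr l)\<close>).\<close>

type_synonym ('s, 'l) feat = "unit + 's + 'l"

lemma card_feat: "CARD(('s::finite, 'l::finite) feat) = 1 + CARD('s) + CARD('l)"
  by simp

text \<open>The entries of the outer vector are the rows of the matrix.\<close>

definition text_matrix ::
    "real ^ ('s::finite, 'l::finite) feat \<Rightarrow> ('s \<Rightarrow> real ^ ('s, 'l) feat) \<Rightarrow>
     ('l \<Rightarrow> real ^ ('s, 'l) feat) \<Rightarrow> real ^ ('s, 'l) feat ^ ('s, 'l) feat" where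
  "text_matrix \<mu>G \<nu> \<xi> =
     (\<chi> r. case r of Inl _ \<Rightarrow> \<mu>G | Inr (Inl s) \<Rightarrow> \<nu> s | Inr (Inr l) \<Rightarrow> \<xi> l)"

definition coordwise :: "(real \<Rightarrow> real) \<Rightarrow> real ^ 'm \<Rightarrow> real ^ 'm" where
  "coordwise \<sigma> v = (\<chi> r. \<sigma> (v $ r))"

definition text_feature ::
    "(real \<Rightarrow> real) \<Rightarrow> real ^ 'm ^ 'm \<Rightarrow> real ^ 'm \<Rightarrow> real ^ 'm \<Rightarrow> real ^ 'm" where
  "text_feature \<sigma> W p q = coordwise \<sigma> (W *v p + W *v q) - coordwise \<sigma> (- (W *v p) + W *v q)"

definition image_feature ::
    "int \<Rightarrow> 's \<Rightarrow> ('l \<Rightarrow> real) \<Rightarrow> real ^ ('s::finite, 'l::finite) feat" where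
  "image_feature y s x =
     (\<chi> r. case r of Inl _ \<Rightarrow> of_int y
                  | Inr (Inl s') \<Rightarrow> (if s' = s then of_int y else 0)
                  | Inr (Inr l) \<Rightarrow> x l)"

text \<open>Loss of one client with samples \<open>1, \<dots>, N\<close>, labels \<open>y\<close>, image features \<open>g\<close>, and class
  prompts \<open>q\<close>, of which only \<open>q 1\<close> and \<open>q (-1)\<close> matter.\<close>

definition client_loss ::
    "(real \<Rightarrow> real) \<Rightarrow> real ^ 'm ^ 'm \<Rightarrow> (int \<Rightarrow> real ^ 'm) \<Rightarrow> nat \<Rightarrow> (nat \<Rightarrow> int) \<Rightarrow>
     (nat \<Rightarrow> real ^ 'm) \<Rightarrow> real ^ 'm \<Rightarrow> real" where
  "client_loss \<sigma> W q N y g p =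
     1 / real N * (\<Sum>i = 1..N. ln (1 + exp (- inner (g i) (text_feature \<sigma> W p (q (y i))))))"

definition gradient :: "('a::real_inner \<Rightarrow> real) \<Rightarrow> 'a \<Rightarrow> 'a" where
  "gradient f x = (THE D. GDERIV f x :> D)"

definition fedavg :: "('k::finite \<Rightarrow> nat) \<Rightarrow> ('k \<Rightarrow> 'a::real_vector) \<Rightarrow> 'a" where
  "fedavg n v = (\<Sum>k\<in>UNIV. (real (n k) / real (\<Sum>j\<in>UNIV. n j)) *\<^sub>R v k)"

definition local_step ::
    "real \<Rightarrow> ('k \<Rightarrow> 'a::real_inner \<Rightarrow> real) \<Rightarrow> ('k \<Rightarrow> 'a) \<Rightarrow> 'k \<Rightarrow> 'a" where
  "local_step \<eta> loss p k = p k - \<eta> *\<^sub>R gradient (loss k) (p k)"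

text \<open>\<open>t\<close> counts local gradient steps. When \<open>t\<close> is a positive multiple of \<open>E\<close>, the value at \<open>t\<close> is
  the one after aggregation.\<close>

primrec fed_prompt ::
    "nat \<Rightarrow> real \<Rightarrow> ('k::finite \<Rightarrow> nat) \<Rightarrow> ('k \<Rightarrow> 'a::real_inner \<Rightarrow> real) \<Rightarrow> ('k \<Rightarrow> 'a) \<Rightarrow>
     nat \<Rightarrow> 'k \<Rightarrow> 'a" where
  "fed_prompt E \<eta> n loss p0 0 = p0"
| "fed_prompt E \<eta> n loss p0 (Suc t) =
     (let p' = local_step \<eta> loss (fed_prompt E \<eta> n loss p0 t)
      in if E dvd Suc t then (\<lambda>k. fedavg n p') else p')"

end

theory Submission
  imports Defs
begin

text \<open>The loss of a client depends on the prompt only through the rows of the text matrix, so its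
  gradient is a combination of those rows on which some image feature of the client is nonzero: the
  global feature, the local signal of this client and the task-irrelevant features. Hence gradient
  steps and averaging stay in the span of these vectors and the initial prompts. Averaging is
  linear, so the averaged coefficients represent the averaged prompt for any choice of coefficients.\<close>

text \<open>Two gradients at the same point induce the same functional \<open>inner _ D\<close>.
  Evaluating it at their difference shows that the difference has norm zero, so the definite
  description in \<open>gradient\<close> is well defined.\<close>

lemma gradient_eqI:
  assumes "GDERIV f x :> D"
  shows "gradient f x = D"
proof -
  have "D' = D" if "GDERIV f x :> D'" for D'
  proof -
    have "(\<lambda>h. inner h D') = (\<lambda>h. inner h D)"
      using that assms unfolding gderiv_def by (rule has_derivative_unique)
    then have "inner (D' - D) D' = inner (D' - D) D"
      by meson
    then show ?thesis
      by (metis inner_diff_right inner_eq_zero_iff eq_iff_diff_eq_0)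
  qed
  with assms show ?thesis
    unfolding gradient_def by (intro the_equality)
qed

text \<open>Chain rule: coordinate \<open>r\<close> of the text feature sees \<open>p\<close> only
  through \<open>inner (W $ r) p\<close>, so it contributes a multiple of row \<open>r\<close>. The
  sign in front of the second activation cancels the sign of \<open>- (W *v p)\<close>, hence the
  sum of the two derivatives.\<close>

lemma GDERIV_inner_text_feature:
  fixes W :: "real ^ 'm::finite ^ 'm"
  assumes "\<And>u. (\<sigma> has_real_derivative \<sigma>' u) (at u)"
  shows "GDERIV (\<lambda>p. inner v (text_feature \<sigma> W p q)) p :>
    (\<Sum>r\<in>UNIV. (v $ r * (\<sigma>' ((W *v p + W *v q) $ r) + \<sigma>' ((- (W *v p) + W *v q) $ r))) *\<^sub>R W $ r)"
proof -
  have row: "(W *v z) $ r = inner (W $ r) z" for z r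
    by (simp add: matrix_vector_mul_component)
  \<comment> \<open>Both pre-activations are affine in \<open>p\<close>; \<open>c\<close> will be
    the contribution of the fixed prompt \<open>q\<close>.\<close>
  have "((\<lambda>p. inner (W $ r) p + c) has_derivative (\<lambda>h. inner (W $ r) h)) (at p)"
    "((\<lambda>p. - inner (W $ r) p + c) has_derivative (\<lambda>h. - inner (W $ r) h)) (at p)" for r c
    by (auto intro!: derivative_eq_intros)
  note affine = this[THEN DERIV_compose_FDERIV[OF assms]]
  show ?thesis
    \<comment> \<open>Fixing the first argument to \<open>v\<close> expands only the outer inner
      product and leaves those with the rows of \<open>W\<close> intact, as \<open>affine\<close>
      requires.\<close>
    unfolding gderiv_def inner_vec_def[of v] text_feature_def coordwise_def
      vector_minus_component vector_add_component vector_uminus_component vec_lambda_beta row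
      inner_real_def inner_sum_right inner_scaleR_right
    by (rule has_derivative_eq_rhs, rule has_derivative_sum, rule has_derivative_mult_right,
        rule has_derivative_diff, rule affine, rule affine)
      (simp add: fun_eq_iff inner_commute algebra_simps)
qed

text \<open>Each sample contributes a multiple of the gradient of its inner product, in which row
  \<open>r\<close> carries the factor \<open>g i $ r\<close>. Recording which rows drop out matters:
  a local feature that is no client's signal has no term in the final expansion.\<close>

lemma gradient_client_loss_in_span:
  fixes W :: "real ^ 'm::finite ^ 'm"
  assumes "\<And>u. (\<sigma> has_real_derivative \<sigma>' u) (at u)"
  shows "gradient (client_loss \<sigma> W q N y g) p \<in> span {W $ r |r. \<exists>i\<in>{1..N}. g i $ r \<noteq> 0}"
    (is "_ \<in> span ?R")
proof -
  define G where "G i = (\<Sum>r\<in>UNIV. (g i $ r * (\<sigma>' ((W *v p + W *v q (y i)) $ r)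
    + \<sigma>' ((- (W *v p) + W *v q (y i)) $ r))) *\<^sub>R W $ r)" for i
  define a where "a i = inner (g i) (text_feature \<sigma> W p (q (y i)))" for i
  have span_G: "G i \<in> span ?R" if "i \<in> {1..N}" for i
    unfolding G_def
  proof (rule span_sum)
    fix r show "(g i $ r * (\<sigma>' ((W *v p + W *v q (y i)) $ r)
      + \<sigma>' ((- (W *v p) + W *v q (y i)) $ r))) *\<^sub>R W $ r \<in> span ?R"
    proof (cases "g i $ r = 0")
      case False
      with that have "W $ r \<in> ?R" by blast
      then show ?thesis by (intro span_scale span_base)
    qed (simp add: span_zero)
  qed
  have "((\<lambda>p. inner (g i) (text_feature \<sigma> W p (q (y i)))) has_derivative (\<lambda>h. inner h (G i))) (at p)" for i
    using GDERIV_inner_text_feature[OF assms] unfolding gderiv_def G_def .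
  note [derivative_intros] = this
  \<comment> \<open>The derivative of \<open>ln (1 + exp (- z))\<close> at
    \<open>z = a i\<close>.\<close>
  define c where "c i = - exp (- a i) / (1 + exp (- a i))" for i
  have "1 + exp z > 0" for z :: real
    by (simp add: add_pos_pos)
  then have "((\<lambda>p. ln (1 + exp (- inner (g i) (text_feature \<sigma> W p (q (y i)))))) has_derivative
      (\<lambda>h. inner h (c i *\<^sub>R G i))) (at p)" for i
    unfolding c_def a_def
    by (auto intro!: derivative_eq_intros simp: fun_eq_iff divide_inverse)
  then have "GDERIV (client_loss \<sigma> W q N y g) p :> (1 / real N) *\<^sub>R (\<Sum>i = 1..N. c i *\<^sub>R G i)"
    \<comment> \<open>Only the outer factor \<open>1 / real N\<close> is pulled out; the scalars
      \<open>c i\<close> stay inside, matching the derivative of each summand.\<close>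
    unfolding gderiv_def client_loss_def inner_scaleR_right[of _ "1 / real N"] inner_sum_right
    by (intro has_derivative_mult_right has_derivative_sum)
  then show ?thesis
    by (simp only: gradient_eqI span_G span_scale span_sum)
qed

lemma fed_prompt_in_subspace:
  assumes S: "subspace S"
    and "\<And>k. p0 k \<in> S"
    and "\<And>k v. gradient (loss k) v \<in> S"
  shows "fed_prompt E \<eta> n loss p0 t k \<in> S"
\<comment> \<open>The client is generalized because an aggregation step mixes the prompts of all
  clients.\<close>
proof (induction t arbitrary: k)
  case (Suc t)
  then have "local_step \<eta> loss (fed_prompt E \<eta> n loss p0 t) j \<in> S" for j
    unfolding local_step_def using assms by (intro subspace_diff subspace_scale)
  then show ?case
    using S by (auto simp: Let_def fedavg_def intro!: subspace_sum subspace_scale)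
qed (simp add: assms)

text \<open>Coefficients are attached to indices rather than to vectors, since \<open>f\<close> may
  repeat values: several clients can share one local signal or one initial prompt.\<close>

lemma in_span_range:
  fixes f :: "'i::finite \<Rightarrow> 'a::real_vector"
  assumes "v \<in> span (range f)"
  obtains c where "v = (\<Sum>i\<in>UNIV. c i *\<^sub>R f i)"
proof -
  have "\<exists>c. v = (\<Sum>i\<in>UNIV. c i *\<^sub>R f i)"
    using assms
  proof (induction rule: span_induct_alt)
    case base
    show ?case by (rule exI[of _ "\<lambda>_. 0"]) simp
  next
    case (step b u w)
    then obtain i c where "u = f i" "w = (\<Sum>i\<in>UNIV. c i *\<^sub>R f i)" by auto
    \<comment> \<open>The new scalar is added to the coefficient of one chosen index
      \<open>i\<close> with \<open>f i = u\<close>.\<close>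
    then have "b *\<^sub>R u + w = (\<Sum>j\<in>UNIV. ((if j = i then b else 0) + c j) *\<^sub>R f j)"
      by (simp add: scaleR_add_left sum.distrib if_distrib[of "\<lambda>z. z *\<^sub>R _"] cong: if_cong)
    then show ?case by (intro exI[of _ "\<lambda>j. (if j = i then b else 0) + c j"])
  qed
  with that show ?thesis by blast
qed

text \<open>As \<open>f i\<close> is nonzero, its squared norm can be absorbed into the coefficient,
  which gives the normalization of the final expansion.\<close>

lemma in_span_range_normalized:
  fixes f :: "'i::finite \<Rightarrow> 'a::real_normed_vector"
  assumes "v \<in> span (range f)" and "\<And>i. f i \<noteq> 0"
  obtains c where "v = (\<Sum>i\<in>UNIV. (c i / (norm (f i))\<^sup>2) *\<^sub>R f i)"
proof -
  from assms(1) obtain c where "v = (\<Sum>i\<in>UNIV. c i *\<^sub>R f i)"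
    by (rule in_span_range)
  with assms(2) have "v = (\<Sum>i\<in>UNIV. (c i * (norm (f i))\<^sup>2 / (norm (f i))\<^sup>2) *\<^sub>R f i)"
    by simp
  then show ?thesis by (rule that)
qed

lemma fedavg_add: "fedavg n (\<lambda>j. u j + v j) = fedavg n u + fedavg n v"
  by (simp add: fedavg_def scaleR_add_right sum.distrib)

lemma fedavg_sum: "fedavg n (\<lambda>j. \<Sum>i\<in>A. v j i) = (\<Sum>i\<in>A. fedavg n (\<lambda>j. v j i))"
  unfolding fedavg_def scaleR_sum_right by (rule sum.swap)

text \<open>Here averaging of vectors turns into averaging of real coefficients, so
  \<open>fedavg\<close> occurs at two types.\<close>

lemma fedavg_scaleR_left: "fedavg n (\<lambda>j. c j *\<^sub>R v) = fedavg n c *\<^sub>R v"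
  by (simp add: fedavg_def scaleR_sum_left)

lemma fedavg_divide: "fedavg n (\<lambda>j. c j / d) = fedavg n c / (d::real)"
  by (simp add: fedavg_def sum_divide_distrib)

theorem lemma4p1:
  fixes \<mu>G :: "real ^ ('s::finite, 'l::finite) feat"
    and \<nu> :: "'s \<Rightarrow> real ^ ('s, 'l) feat"
    and \<xi> :: "'l \<Rightarrow> real ^ ('s, 'l) feat"
    and \<sigma> \<sigma>' :: "real \<Rightarrow> real"
    and q :: "int \<Rightarrow> real ^ ('s, 'l) feat"
    and M :: "'w measure"
    and D :: "'s pmf"
    and s :: "'k::finite \<Rightarrow> 'w \<Rightarrow> 's"
    and n :: "'k \<Rightarrow> nat"
    and y :: "'k \<Rightarrow> nat \<Rightarrow> 'w \<Rightarrow> int"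
    and x :: "'k \<Rightarrow> nat \<Rightarrow> 'l \<Rightarrow> 'w \<Rightarrow> real"
    and \<sigma>p \<eta> :: real
    and E :: nat
    and p0 :: "'k \<Rightarrow> real ^ ('s, 'l) feat"
    and \<mu> :: "'w \<Rightarrow> 'k \<Rightarrow> real ^ ('s, 'l) feat"
    and W :: "real ^ ('s, 'l) feat ^ ('s, 'l) feat"
    and g :: "'w \<Rightarrow> 'k \<Rightarrow> nat \<Rightarrow> real ^ ('s, 'l) feat"
    and loss :: "'w \<Rightarrow> 'k \<Rightarrow> real ^ ('s, 'l) feat \<Rightarrow> real"
    and p :: "'w \<Rightarrow> nat \<Rightarrow> 'k \<Rightarrow> real ^ ('s, 'l) feat"
  assumes feat_nonzero: "\<mu>G \<noteq> 0" "\<And>a. \<nu> a \<noteq> 0" "\<And>l. \<xi> l \<noteq> 0"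
    and feat_orth: "\<And>a. orthogonal \<mu>G (\<nu> a)" "\<And>l. orthogonal \<mu>G (\<xi> l)"
      "\<And>a l. orthogonal (\<nu> a) (\<xi> l)"
      "\<And>a a'. a \<noteq> a' \<Longrightarrow> orthogonal (\<nu> a) (\<nu> a')"
      "\<And>l l'. l \<noteq> l' \<Longrightarrow> orthogonal (\<xi> l) (\<xi> l')"
    and activation: "\<And>u. (\<sigma> has_real_derivative \<sigma>' u) (at u)"
    and prob: "prob_space M"
    and signal: "\<And>k. s k \<in> measurable M (count_space UNIV)"
      "\<And>k. distr M (count_space UNIV) (s k) = measure_pmf D"
    and samples: "\<And>k. n k \<ge> 1"
    and labels: "\<And>k i. i \<in> {1..n k} \<Longrightarrow> y k i \<in> measurable M (count_space UNIV)"
      "\<And>k i \<omega>. i \<in> {1..n k} \<Longrightarrow> \<omega> \<in> space M \<Longrightarrow> y k i \<omega> \<in> {1, -1}"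
    and noise: "\<sigma>p > 0"
      "\<And>k i l. i \<in> {1..n k} \<Longrightarrow> distributed M lborel (x k i l) (normal_density 0 \<sigma>p)"
      "prob_space.indep_vars M (\<lambda>_. borel) (\<lambda>(k, i, l). x k i l) {(k, i, l). i \<in> {1..n k}}"
    and local_steps: "E \<ge> 1"
    and mu: "\<And>\<omega> k. \<mu> \<omega> k = \<nu> (s k \<omega>)"
    and W: "W = text_matrix \<mu>G \<nu> \<xi>"
    and g: "\<And>\<omega> k i. g \<omega> k i = image_feature (y k i \<omega>) (s k \<omega>) (\<lambda>l. x k i l \<omega>)"
    and loss: "\<And>\<omega> k. loss \<omega> k = client_loss \<sigma> W q (n k) (\<lambda>i. y k i \<omega>) (g \<omega> k)"
    and p: "\<And>\<omega>. p \<omega> = fed_prompt E \<eta> n (loss \<omega>) p0"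
  shows "\<forall>\<omega>\<in>space M. \<exists>\<alpha> \<beta> \<gamma> \<phi>. \<forall>t.
      (\<forall>k. p \<omega> t k =
          (\<beta> t k / (norm \<mu>G)\<^sup>2) *\<^sub>R \<mu>G
        + (\<Sum>k'\<in>UNIV. \<alpha> t k k' *\<^sub>R p0 k' + (\<gamma> t k k' / (norm (\<mu> \<omega> k'))\<^sup>2) *\<^sub>R \<mu> \<omega> k')
        + (\<Sum>l\<in>UNIV. (\<phi> t k l / (norm (\<xi> l))\<^sup>2) *\<^sub>R \<xi> l)) \<and>
      fedavg n (p \<omega> t) =
          (fedavg n (\<lambda>j. \<beta> t j) / (norm \<mu>G)\<^sup>2) *\<^sub>R \<mu>G
        + (\<Sum>k\<in>UNIV. fedavg n (\<lambda>j. \<alpha> t j k) *\<^sub>R p0 k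
                    + (fedavg n (\<lambda>j. \<gamma> t j k) / (norm (\<mu> \<omega> k))\<^sup>2) *\<^sub>R \<mu> \<omega> k)
        + (\<Sum>l\<in>UNIV. (fedavg n (\<lambda>j. \<phi> t j l) / (norm (\<xi> l))\<^sup>2) *\<^sub>R \<xi> l)"
proof
  fix \<omega> assume "\<omega> \<in> space M"
  let ?A = "{\<mu>G}" and ?B = "range p0" and ?C = "range (\<mu> \<omega>)" and ?D = "range \<xi>"
  \<comment> \<open>The unions are bracketed like the sums in the target expansion, where the terms
    of \<open>p0\<close> and \<open>\<mu> \<omega>\<close> share one sum over clients.\<close>
  let ?S = "span (?A \<union> (?B \<union> ?C) \<union> ?D)"
  have "gradient (loss \<omega> k) v \<in> ?S" for k v
  proof -
    \<comment> \<open>Among the local rows, a nonzero image coordinate forces the index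
      \<open>s k \<omega>\<close>, whose row is \<open>\<mu> \<omega> k\<close>. The global and
      noise rows are \<open>\<mu>G\<close> and the values of \<open>\<xi>\<close>.\<close>
    have "{W $ r |r. \<exists>i\<in>{1..n k}. g \<omega> k i $ r \<noteq> 0} \<subseteq> ?A \<union> (?B \<union> ?C) \<union> ?D"
      by (auto simp: split_sum_ex W g mu text_matrix_def image_feature_def split: if_splits)
    from span_mono[OF this] show ?thesis
      using gradient_client_loss_in_span[OF activation] unfolding loss by blast
  qed
  then have "p \<omega> t k \<in> ?S" for t k
    unfolding p by (intro fed_prompt_in_subspace) (auto intro: span_base)
  have "\<forall>t k. \<exists>b a c f. p \<omega> t k = (b / (norm \<mu>G)\<^sup>2) *\<^sub>R \<mu>G
      + (\<Sum>k'\<in>UNIV. a k' *\<^sub>R p0 k' + (c k' / (norm (\<mu> \<omega> k'))\<^sup>2) *\<^sub>R \<mu> \<omega> k')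
      + (\<Sum>l\<in>UNIV. (f l / (norm (\<xi> l))\<^sup>2) *\<^sub>R \<xi> l)"
  proof (intro allI)
    fix t k
    \<comment> \<open>The span of a union is the set of sums of elements of the spans, so the prompt
      splits into one component per family of vectors.\<close>
    obtain b' vB vC vD where v: "p \<omega> t k = b' *\<^sub>R \<mu>G + (vB + vC) + vD"
      and "vB \<in> span ?B" "vC \<in> span ?C" "vD \<in> span ?D"
      using \<open>p \<omega> t k \<in> ?S\<close> unfolding span_Un span_singleton by auto
    moreover from this obtain a where "vB = (\<Sum>k'\<in>UNIV. a k' *\<^sub>R p0 k')"
      by (elim in_span_range)
    moreover have "\<mu> \<omega> k' \<noteq> 0" for k'
      using feat_nonzero mu by simp
    with \<open>vC \<in> span ?C\<close> obtain c where "vC = (\<Sum>k'\<in>UNIV. (c k' / (norm (\<mu> \<omega> k'))\<^sup>2) *\<^sub>R \<mu> \<omega> k')"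
      by (rule in_span_range_normalized)
    moreover from \<open>vD \<in> span ?D\<close> feat_nonzero(3)
    obtain f where "vD = (\<Sum>l\<in>UNIV. (f l / (norm (\<xi> l))\<^sup>2) *\<^sub>R \<xi> l)"
      by (rule in_span_range_normalized)
    moreover have "b' = b' * (norm \<mu>G)\<^sup>2 / (norm \<mu>G)\<^sup>2"
      using feat_nonzero by simp
    ultimately have "p \<omega> t k = (b' * (norm \<mu>G)\<^sup>2 / (norm \<mu>G)\<^sup>2) *\<^sub>R \<mu>G
      + (\<Sum>k'\<in>UNIV. a k' *\<^sub>R p0 k' + (c k' / (norm (\<mu> \<omega> k'))\<^sup>2) *\<^sub>R \<mu> \<omega> k')
      + (\<Sum>l\<in>UNIV. (f l / (norm (\<xi> l))\<^sup>2) *\<^sub>R \<xi> l)"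
      using v by (simp add: sum.distrib)
    then show "\<exists>b a c f. p \<omega> t k = (b / (norm \<mu>G)\<^sup>2) *\<^sub>R \<mu>G
      + (\<Sum>k'\<in>UNIV. a k' *\<^sub>R p0 k' + (c k' / (norm (\<mu> \<omega> k'))\<^sup>2) *\<^sub>R \<mu> \<omega> k')
      + (\<Sum>l\<in>UNIV. (f l / (norm (\<xi> l))\<^sup>2) *\<^sub>R \<xi> l)"
      by blast
  qed
  \<comment> \<open>Choice over iterations and clients turns the pointwise coefficients into
    functions of \<open>t\<close> and \<open>k\<close>.\<close>
  then obtain \<beta> \<alpha> \<gamma> \<phi> where rep: "\<And>t k. p \<omega> t k =
      (\<beta> t k / (norm \<mu>G)\<^sup>2) *\<^sub>R \<mu>G
      + (\<Sum>k'\<in>UNIV. \<alpha> t k k' *\<^sub>R p0 k' + (\<gamma> t k k' / (norm (\<mu> \<omega> k'))\<^sup>2) *\<^sub>R \<mu> \<omega> k')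
      + (\<Sum>l\<in>UNIV. (\<phi> t k l / (norm (\<xi> l))\<^sup>2) *\<^sub>R \<xi> l)"
    unfolding choice_iff by blast
  then have "fedavg n (p \<omega> t) =
      (fedavg n (\<lambda>j. \<beta> t j) / (norm \<mu>G)\<^sup>2) *\<^sub>R \<mu>G
      + (\<Sum>k\<in>UNIV. fedavg n (\<lambda>j. \<alpha> t j k) *\<^sub>R p0 k
                  + (fedavg n (\<lambda>j. \<gamma> t j k) / (norm (\<mu> \<omega> k))\<^sup>2) *\<^sub>R \<mu> \<omega> k)
      + (\<Sum>l\<in>UNIV. (fedavg n (\<lambda>j. \<phi> t j l) / (norm (\<xi> l))\<^sup>2) *\<^sub>R \<xi> l)" for t
    \<comment> \<open>Extensionality rewrites the whole family of client prompts, so that linearity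
      of \<open>fedavg\<close> applies term by term to the same coefficients.\<close>
    unfolding ext[of "p \<omega> t", OF rep]
    by (simp add: fedavg_add fedavg_sum fedavg_scaleR_left fedavg_divide)
  with rep show "\<exists>\<alpha> \<beta> \<gamma> \<phi>. \<forall>t.
      (\<forall>k. p \<omega> t k =
          (\<beta> t k / (norm \<mu>G)\<^sup>2) *\<^sub>R \<mu>G
        + (\<Sum>k'\<in>UNIV. \<alpha> t k k' *\<^sub>R p0 k' + (\<gamma> t k k' / (norm (\<mu> \<omega> k'))\<^sup>2) *\<^sub>R \<mu> \<omega> k')
        + (\<Sum>l\<in>UNIV. (\<phi> t k l / (norm (\<xi> l))\<^sup>2) *\<^sub>R \<xi> l)) \<and>
      fedavg n (p \<omega> t) =
          (fedavg n (\<lambda>j. \<beta> t j) / (norm \<mu>G)\<^sup>2) *\<^sub>R \<mu>G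
        + (\<Sum>k\<in>UNIV. fedavg n (\<lambda>j. \<alpha> t j k) *\<^sub>R p0 k
                    + (fedavg n (\<lambda>j. \<gamma> t j k) / (norm (\<mu> \<omega> k))\<^sup>2) *\<^sub>R \<mu> \<omega> k)
        + (\<Sum>l\<in>UNIV. (fedavg n (\<lambda>j. \<phi> t j l) / (norm (\<xi> l))\<^sup>2) *\<^sub>R \<xi> l)"
    by blast
qed

end
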